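(* Let $d\ge 2$ and let $\phi\in\mathrm{Rat}_d$ be a pseudo-real rational map. Then $\mathrm{Aut}(\phi)$ is either trivial or a cyclic group.
   Context: $\mathrm{Rat}_d$ is the space of complex rational maps of degree $d\ge 2$. $\mathrm{Aut}(\phi)=\{T\in\mathrm{PSL}_2(\mathbb{C}): T\circ\phi\circ T^{-1}=\phi\}$ is the group of holomorphic automorphisms of $\phi$. An extended Möbius transformation is a map $Q=T\circ J$ with $T\in\mathrm{PSL}_2(\mathbb{C})$ and $J(z)=\overline z$; it is an antiholomorphic automorphism of $\phi$ if $Q\circ\phi\circ Q^{-1}=\phi$. A reflection is an antiholomorphic involution of $\widehat{\mathbb{C}}$ with fixed points (a circle of fixed points). A rational map is pseudo-real if it admits antiholomorphic automorphisms but none of them is a reflection. *)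

theory Defs
  imports
    Complex_Main
    "HOL-Computational_Algebra.Polynomial"
    "HOL-Algebra.Elementary_Groups"
begin

text \<open>The Riemann sphere is \<^typ>\<open>complex option\<close>, with \<^term>\<open>None\<close> as the point at infinity
  (the carrier convention of the one-point compactification in HOL-Analysis).\<close>

type_synonym sphere = "complex option"

text \<open>For coprime \<open>p\<close>, \<open>q\<close>, the two coefficients at \<open>max (degree p) (degree q)\<close> are the values at
  \<open>(1 : 0)\<close> of the homogenizations of \<open>p\<close> and \<open>q\<close> to that common degree, so their quotient is
  the value at infinity.\<close>

definition rat_map :: "complex poly \<Rightarrow> complex poly \<Rightarrow> sphere \<Rightarrow> sphere" where
  "rat_map p q z =
     (case z of
        Some w \<Rightarrow> if poly q w = 0 then None else Some (poly p w / poly q w)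
      | None \<Rightarrow>
          (let n = max (degree p) (degree q)
           in if coeff q n = 0 then None else Some (coeff p n / coeff q n)))"

definition Rat_maps :: "nat \<Rightarrow> (sphere \<Rightarrow> sphere) set" where
  "Rat_maps d = {rat_map p q | p q. coprime p q \<and> max (degree p) (degree q) = d}"

definition moebius :: "complex \<Rightarrow> complex \<Rightarrow> complex \<Rightarrow> complex \<Rightarrow> sphere \<Rightarrow> sphere" where
  "moebius a b c d z =
     (case z of
        Some w \<Rightarrow> if c * w + d = 0 then None else Some ((a * w + b) / (c * w + d))
      | None \<Rightarrow> if c = 0 then None else Some (a / c))"

text \<open>\<open>PSL\<^sub>2(\<complex>)\<close> in its faithful action on the sphere: two matrices of determinant 1 give the
  same map iff they agree up to sign.\<close>

definition PSL2C :: "(sphere \<Rightarrow> sphere) monoid" where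
  "PSL2C = \<lparr>carrier = {moebius a b c d | a b c d. a * d - b * c = 1}, mult = (\<circ>), one = id\<rparr>"

text \<open>\<^term>\<open>inv_into UNIV T\<close> is the inverse map of the bijection \<open>T\<close>; HOL-Algebra uses the
  notation \<open>inv\<close> for inverses in a group.\<close>

definition Aut :: "(sphere \<Rightarrow> sphere) \<Rightarrow> (sphere \<Rightarrow> sphere) monoid" where
  "Aut \<phi> = PSL2C\<lparr>carrier := {T \<in> carrier PSL2C. T \<circ> \<phi> \<circ> inv_into UNIV T = \<phi>}\<rparr>"

definition conj_map :: "sphere \<Rightarrow> sphere" where
  "conj_map = map_option cnj"

definition extended_moebius :: "(sphere \<Rightarrow> sphere) set" where
  "extended_moebius = {T \<circ> conj_map | T. T \<in> carrier PSL2C}"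

definition antiholo_aut :: "(sphere \<Rightarrow> sphere) \<Rightarrow> (sphere \<Rightarrow> sphere) set" where
  "antiholo_aut \<phi> = {Q \<in> extended_moebius. Q \<circ> \<phi> \<circ> inv_into UNIV Q = \<phi>}"

text \<open>The antiholomorphic bijections of the sphere are exactly the extended Moebius
  transformations. An involution among them with one fixed point fixes a circle pointwise.\<close>

definition is_reflection :: "(sphere \<Rightarrow> sphere) \<Rightarrow> bool" where
  "is_reflection Q \<longleftrightarrow> Q \<in> extended_moebius \<and> Q \<circ> Q = id \<and> (\<exists>z. Q z = z)"

definition pseudo_real :: "(sphere \<Rightarrow> sphere) \<Rightarrow> bool" where
  "pseudo_real \<phi> \<longleftrightarrow> antiholo_aut \<phi> \<noteq> {} \<and> (\<forall>Q \<in> antiholo_aut \<phi>. \<not> is_reflection Q)"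

text \<open>The records above are groups, so that \<^const>\<open>cyclic_group\<close> has its usual meaning for them.\<close>

lemma moebius_comp:
  assumes "a * d - b * c = 1" and "a' * d' - b' * c' = 1"
  shows "moebius a b c d \<circ> moebius a' b' c' d' =
         moebius (a * a' + b * c') (a * b' + b * d') (c * a' + d * c') (c * b' + d * d')"
proof
  fix z
  have key: "moebius a b c d (if v = 0 then None else Some (u / v)) =
      (if c * u + d * v = 0 then None else Some ((a * u + b * v) / (c * u + d * v)))"
    if "u \<noteq> 0 \<or> v \<noteq> 0" for u v
  proof (cases "v = 0")
    case True
    with that assms(1) show ?thesis by (auto simp: moebius_def)
  next
    case False
    then have "c * (u / v) + d = (c * u + d * v) / v" "a * (u / v) + b = (a * u + b * v) / v"
      by (simp_all add: field_simps)
    with False show ?thesis by (auto simp: moebius_def)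
  qed
  show "(moebius a b c d \<circ> moebius a' b' c' d') z =
        moebius (a * a' + b * c') (a * b' + b * d') (c * a' + d * c') (c * b' + d * d') z"
  proof (cases z)
    case None
    have "a' \<noteq> 0 \<or> c' \<noteq> 0" using assms(2) by auto
    from key[OF this] None show ?thesis by (simp add: moebius_def[of a' b' c' d'] moebius_def[of "a * a' + b * c'"])
  next
    case (Some w)
    have "a' * w + b' \<noteq> 0 \<or> c' * w + d' \<noteq> 0"
    proof (rule ccontr)
      assume "\<not> ?thesis"
      then have "a' * w + b' = 0" "c' * w + d' = 0" by auto
      then have "b' = - a' * w" "d' = - c' * w" by (simp_all add: eq_neg_iff_add_eq_0 add.commute)
      with assms(2) show False by simp
    qed
    from key[OF this] Some show ?thesis
      by (simp add: moebius_def[of a' b' c' d'] moebius_def[of "a * a' + b * c'"] algebra_simps)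
  qed
qed

lemma moebius_id: "moebius 1 0 0 1 = id"
  by (auto simp: moebius_def fun_eq_iff split: option.split)

lemma moebius_inverse:
  assumes "a * d - b * c = 1"
  shows "moebius d (- b) (- c) a \<circ> moebius a b c d = id"
  using assms by (subst moebius_comp) (auto simp: algebra_simps moebius_id [symmetric])

lemma group_PSL2C: "group PSL2C"
proof (rule groupI)
  fix S T assume "S \<in> carrier PSL2C" "T \<in> carrier PSL2C"
  then obtain a b c d a' b' c' d' where
    S: "S = moebius a b c d" "a * d - b * c = 1" and T: "T = moebius a' b' c' d'" "a' * d' - b' * c' = 1"
    by (auto simp: PSL2C_def)
  have "(a * a' + b * c') * (c * b' + d * d') - (a * b' + b * d') * (c * a' + d * c')
      = (a * d - b * c) * (a' * d' - b' * c')"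
    by (simp add: algebra_simps)
  also have "\<dots> = 1" by (simp add: S T)
  finally show "S \<otimes>\<^bsub>PSL2C\<^esub> T \<in> carrier PSL2C"
    using S T by (auto simp: PSL2C_def moebius_comp)
next
  show "\<one>\<^bsub>PSL2C\<^esub> \<in> carrier PSL2C"
    unfolding PSL2C_def
    by simp (rule exI[of _ 1], rule exI[of _ 0], rule exI[of _ 0], rule exI[of _ 1], simp add: moebius_id)
next
  fix T assume "T \<in> carrier PSL2C"
  then obtain a b c d where T: "T = moebius a b c d" "a * d - b * c = 1"
    by (auto simp: PSL2C_def)
  have "moebius d (- b) (- c) a \<in> carrier PSL2C"
    using T(2) unfolding PSL2C_def
    by simp (rule exI[of _ d], rule exI[of _ "- b"], rule exI[of _ "- c"], rule exI[of _ a],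
        simp add: algebra_simps)
  moreover have "moebius d (- b) (- c) a \<otimes>\<^bsub>PSL2C\<^esub> T = \<one>\<^bsub>PSL2C\<^esub>"
    using moebius_inverse[OF T(2)] T(1) by (simp add: PSL2C_def)
  ultimately show "\<exists>S\<in>carrier PSL2C. S \<otimes>\<^bsub>PSL2C\<^esub> T = \<one>\<^bsub>PSL2C\<^esub>" by blast
qed (auto simp: PSL2C_def comp_assoc)

lemma PSL2C_inv:
  assumes "T \<in> carrier PSL2C"
  shows "bij T" and "inv\<^bsub>PSL2C\<^esub> T = inv_into UNIV T"
proof -
  interpret group PSL2C by (rule group_PSL2C)
  have "inv\<^bsub>PSL2C\<^esub> T \<circ> T = id" "T \<circ> inv\<^bsub>PSL2C\<^esub> T = id"
    using l_inv[OF assms] r_inv[OF assms] by (simp_all add: PSL2C_def)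
  then show "bij T" and "inv\<^bsub>PSL2C\<^esub> T = inv_into UNIV T"
    by (auto intro: o_bij inv_unique_comp [symmetric])
qed

lemma subgroup_Aut: "subgroup (carrier (Aut \<phi>)) PSL2C"
proof -
  interpret group PSL2C by (rule group_PSL2C)
  have iff: "T \<in> carrier (Aut \<phi>) \<longleftrightarrow> T \<in> carrier PSL2C \<and> T \<circ> \<phi> = \<phi> \<circ> T" for T
  proof (cases "T \<in> carrier PSL2C")
    case True
    have b: "bij T" by (rule PSL2C_inv(1)[OF True])
    have "T \<circ> \<phi> \<circ> inv_into UNIV T = \<phi> \<longleftrightarrow> T \<circ> \<phi> = \<phi> \<circ> T"
      by (metis b bij_is_inj bij_is_surj comp_assoc comp_id inv_o_cancel surj_iff)
    with True show ?thesis by (simp add: Aut_def)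
  qed (simp add: Aut_def)
  show ?thesis
  proof (rule subgroupI)
    have "\<one>\<^bsub>PSL2C\<^esub> \<in> carrier (Aut \<phi>)"
      unfolding iff by (simp add: one_closed) (simp add: PSL2C_def)
    then show "carrier (Aut \<phi>) \<noteq> {}" by blast
  next
    fix S T assume "S \<in> carrier (Aut \<phi>)" "T \<in> carrier (Aut \<phi>)"
    then have *: "S \<in> carrier PSL2C" "T \<in> carrier PSL2C" "S \<circ> \<phi> = \<phi> \<circ> S" "T \<circ> \<phi> = \<phi> \<circ> T"
      unfolding iff by auto
    then have "(S \<circ> T) \<circ> \<phi> = \<phi> \<circ> (S \<circ> T)" by (metis comp_assoc)
    moreover have "S \<otimes>\<^bsub>PSL2C\<^esub> T = S \<circ> T" by (simp add: PSL2C_def)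
    ultimately show "S \<otimes>\<^bsub>PSL2C\<^esub> T \<in> carrier (Aut \<phi>)"
      using m_closed[OF *(1,2)] unfolding iff by simp
  next
    fix T assume "T \<in> carrier (Aut \<phi>)"
    then have *: "T \<in> carrier PSL2C" "T \<circ> \<phi> = \<phi> \<circ> T" unfolding iff by auto
    have "inv_into UNIV T \<circ> \<phi> = \<phi> \<circ> inv_into UNIV T"
      by (metis *(2) PSL2C_inv(1)[OF *(1)] bij_is_inj bij_is_surj comp_assoc comp_id id_comp
          inv_o_cancel surj_iff)
    then show "inv\<^bsub>PSL2C\<^esub> T \<in> carrier (Aut \<phi>)"
      using inv_closed[OF *(1)] PSL2C_inv(2)[OF *(1)] unfolding iff by simp
  qed (auto simp: Aut_def)
qed

lemma group_Aut: "group (Aut \<phi>)"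
  using group.subgroup_imp_group[OF group_PSL2C subgroup_Aut[of \<phi>]] by (simp add: Aut_def)

end

theory Submission
  imports Defs "HOL-Computational_Algebra.Fundamental_Theorem_Algebra"
begin

text \<open>
  Why the theorem holds. Let \<open>G\<close> be the automorphism group of \<open>\<phi>\<close> and \<open>H\<close> the group of all
  holomorphic and antiholomorphic automorphisms.

  The group \<open>G\<close> is finite, because it permutes a finite set with at least three points, and a
  Moebius transformation is determined by its values at three points. Such a set is found among
  the iterated preimages of the set of fixed points of \<open>\<phi>\<close>. These grow to at least three
  points unless each fixed point is its own only preimage; but then \<open>\<phi>\<close> is totally ramified at
  each fixed point, all fixed points are simple, and there are \<open>d + 1 \<ge> 3\<close> of them
  (\<open>rat_map_finite_invariant_set\<close>).

  Pseudo-reality means that the antiholomorphic elements of \<open>H\<close> act without fixed points: if one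
  of them, \<open>Q\<close>, fixes a point, move that point to infinity, so that \<open>Q\<close> becomes
  \<open>z \<mapsto> a * cnj z + b\<close>. Its square is affine with multiplier \<open>\<bar>a\<bar>\<^sup>2 \<ge> 0\<close> and has finite order, hence is
  the identity, and \<open>Q\<close> is a reflection (\<open>extended_moebius_fixed_point_reflection\<close>).

  Suppose now that \<open>G\<close> is nontrivial. Let \<open>P\<close> be the finite set of points fixed by some element of
  \<open>H\<close> other than the identity. Each such element of \<open>G\<close> fixes exactly two points and the elements
  outside \<open>G\<close> fix none, so with \<open>m = card H = 2 * card G\<close> and \<open>H\<^sub>x\<close> the stabilizer of \<open>x\<close>,
  \<open>(\<Sum>x\<in>P. (card H\<^sub>x - 1)) = 2 * (card G - 1) = m - 2\<close>.
  An orbit in \<open>P\<close> with stabilizers of order \<open>r \<ge> 2\<close> contributes \<open>m - m / r \<ge> m / 2\<close> to the left side,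
  so \<open>P\<close> is a single orbit, and then \<open>r = m / 2 = card G\<close>. Since stabilizers lie in \<open>G\<close>, the whole
  group \<open>G\<close> fixes the points of \<open>P\<close> (\<open>index_two_free_complement_common_fixed_point\<close>). This replaces the
  classification of the finite subgroups of \<open>PSL\<^sub>2(\<complex>)\<close> and handles the dihedral, tetrahedral,
  octahedral and icosahedral groups at once.

  Finally, a finite group of Moebius transformations with a common fixed point is cyclic: with that
  point at infinity its elements are affine, the multiplier embeds the group into the nonzero
  complex numbers, and its image is the group of all \<open>n\<close>-th roots of unity for some \<open>n\<close>
  (\<open>finite_PSL2C_group_fixing_point_cyclic\<close>).
\<close>

section \<open>Finite groups of transformations\<close>

text \<open>A group is represented by its set of maps, because the counting below compares two groups, the
  holomorphic automorphisms and all automorphisms, inside the maps of one sphere.\<close>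

definition transformation_group :: "('a \<Rightarrow> 'a) set \<Rightarrow> bool" where
  "transformation_group G \<longleftrightarrow> id \<in> G \<and> (\<forall>g\<in>G. \<forall>h\<in>G. g \<circ> h \<in> G) \<and>
     (\<forall>g\<in>G. \<exists>h\<in>G. h \<circ> g = id \<and> g \<circ> h = id)"

lemma transformation_groupD:
  assumes "transformation_group G"
  shows "id \<in> G" "g \<in> G \<Longrightarrow> h \<in> G \<Longrightarrow> g \<circ> h \<in> G"
    "g \<in> G \<Longrightarrow> \<exists>h\<in>G. h \<circ> g = id \<and> g \<circ> h = id"
  using assms by (auto simp: transformation_group_def)

lemma transformation_group_bij:
  assumes "transformation_group G" "g \<in> G"
  shows "bij g"
  using transformation_groupD(3)[OF assms] o_bij by blast

lemma transformation_group_funpow: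
  assumes "transformation_group G" "g \<in> G"
  shows "g ^^ n \<in> G"
proof (induction n)
  case 0
  show ?case using transformation_groupD(1)[OF assms(1)] by (simp add: id_def)
next
  case (Suc n)
  show ?case using transformation_groupD(2)[OF assms Suc] by (simp only: funpow.simps)
qed

text \<open>Two powers of \<open>g\<close> coincide by the pigeonhole principle, and \<open>g\<close> can be cancelled. Iterates are
  used instead of group powers since they interact directly with the affine normal form below.\<close>

lemma finite_transformation_group_order:
  assumes G: "transformation_group G" "finite G" "g \<in> G"
  shows "\<exists>n>0. g ^^ n = id"
proof -
  have "range (\<lambda>n. g ^^ n) \<subseteq> G"
    using transformation_group_funpow[OF G(1,3)] by blast
  then have "\<not> inj (\<lambda>n. g ^^ n)"
    using G(2) finite_subset finite_imageD infinite_UNIV_nat by blast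
  then obtain i j where ij: "i < j" "g ^^ i = g ^^ j"
    unfolding inj_def by (metis linorder_less_linear)
  have "bij (g ^^ i)"
    by (rule transformation_group_bij[OF G(1) transformation_group_funpow[OF G(1,3)]])
  moreover have "(g ^^ i) ((g ^^ (j - i)) x) = (g ^^ i) x" for x
  proof -
    have "(g ^^ i) ((g ^^ (j - i)) x) = (g ^^ (i + (j - i))) x"
      by (simp add: funpow_add)
    then show ?thesis using ij by simp
  qed
  ultimately have "g ^^ (j - i) = id"
    by (intro ext) (metis bij_is_inj id_apply injD)
  then show ?thesis using ij(1) by (intro exI[of _ "j - i"]) simp
qed

abbreviation orbit_of :: "('a \<Rightarrow> 'a) set \<Rightarrow> 'a \<Rightarrow> 'a set" where
  "orbit_of G x \<equiv> (\<lambda>g. g x) ` G"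

abbreviation stabilizer_of :: "('a \<Rightarrow> 'a) set \<Rightarrow> 'a \<Rightarrow> ('a \<Rightarrow> 'a) set" where
  "stabilizer_of G x \<equiv> {g \<in> G. g x = x}"

lemma orbit_of_eq:
  assumes G: "transformation_group G" and y: "y \<in> orbit_of G x"
  shows "orbit_of G y = orbit_of G x"
proof -
  obtain g where g: "g \<in> G" "y = g x" using y by auto
  obtain h where h: "h \<in> G" "h \<circ> g = id" using transformation_groupD(3)[OF G g(1)] by blast
  have x: "x = h y" using h(2) g(2) by (metis comp_apply id_apply)
  show ?thesis
  proof (intro equalityI subsetI)
    fix z assume "z \<in> orbit_of G y"
    then obtain k where "k \<in> G" "z = k y" by auto
    then show "z \<in> orbit_of G x"
      using transformation_groupD(2)[OF G _ g(1), of k] g(2) by (auto intro!: image_eqI[of _ _ "k \<circ> g"])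
  next
    fix z assume "z \<in> orbit_of G x"
    then obtain k where "k \<in> G" "z = k x" by auto
    then show "z \<in> orbit_of G y"
      using transformation_groupD(2)[OF G _ h(1), of k] x by (auto intro!: image_eqI[of _ _ "k \<circ> h"])
  qed
qed

text \<open>The evaluation map \<open>h \<mapsto> h x\<close> has the orbit as its image, and each of its fibres is a translate of
  the stabilizer.\<close>

lemma orbit_stabilizer:
  assumes G: "transformation_group G" and fin: "finite G"
  shows "card (orbit_of G x) * card (stabilizer_of G x) = card G"
proof -
  have fibre: "card {h \<in> G. h x = y} = card (stabilizer_of G x)" if y: "y \<in> orbit_of G x" for y
  proof -
    obtain g where g: "g \<in> G" "y = g x" using y by auto
    obtain k where k: "k \<in> G" "k \<circ> g = id" "g \<circ> k = id"
      using transformation_groupD(3)[OF G g(1)] by blast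
    have "bij_betw (\<lambda>h. g \<circ> h) (stabilizer_of G x) {h \<in> G. h x = y}"
    proof (rule bij_betw_byWitness[where f' = "\<lambda>h. k \<circ> h"])
      show "\<forall>h\<in>stabilizer_of G x. k \<circ> (g \<circ> h) = h"
        by (simp add: k(2) flip: comp_assoc)
      show "\<forall>h\<in>{h \<in> G. h x = y}. g \<circ> (k \<circ> h) = h"
        by (simp add: k(3) flip: comp_assoc)
      show "(\<lambda>h. g \<circ> h) ` stabilizer_of G x \<subseteq> {h \<in> G. h x = y}"
        using g(2) transformation_groupD(2)[OF G g(1)] by (simp add: image_subset_iff)
      have "k (g x) = x" using k(2) by (metis comp_apply id_apply)
      then show "(\<lambda>h. k \<circ> h) ` {h \<in> G. h x = y} \<subseteq> stabilizer_of G x"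
        using g(2) transformation_groupD(2)[OF G k(1)] by (simp add: image_subset_iff)
    qed
    then show ?thesis by (simp add: bij_betw_same_card)
  qed
  have "card G = (\<Sum>y\<in>orbit_of G x. card {h \<in> G. h x = y})"
    using sum.image_gen[OF fin, of "\<lambda>_. 1::nat" "\<lambda>h. h x"] by simp
  also have "\<dots> = card (orbit_of G x) * card (stabilizer_of G x)"
    by (simp add: fibre)
  finally show ?thesis by simp
qed

text \<open>The counting argument at the heart of the theorem. The elements outside \<open>G\<close> contribute nothing to
  the number of pairs (non-identity element, fixed point), so this number is \<open>card H - 2\<close> instead
  of the \<open>2 * card H - 2\<close> of a rotation group. That leaves room for one orbit of points with
  nontrivial stabilizer, and forces its stabilizers to have index 2.\<close>

lemma index_two_free_complement_common_fixed_point: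
  fixes H G :: "('a \<Rightarrow> 'a) set"
  assumes H: "transformation_group H" and fin: "finite H"
    and GH: "G \<subseteq> H" and half: "card H = 2 * card G"
    and two: "\<And>g. g \<in> G \<Longrightarrow> g \<noteq> id \<Longrightarrow> card {x. g x = x} = 2"
    and free: "\<And>h x. h \<in> H \<Longrightarrow> h \<notin> G \<Longrightarrow> h x \<noteq> x"
    and nontriv: "g0 \<in> G" "g0 \<noteq> id" "g0 p = p"
    and g: "g \<in> G"
  shows "g p = p"
proof -
  define P where "P = {x. \<exists>h\<in>H. h \<noteq> id \<and> h x = x}"
  define s where "s x = card {h \<in> H - {id}. h x = x}" for x
  have idG: "id \<in> G" using free[of id] transformation_groupD(1)[OF H] by auto
  have two': "card {x. h x = x} = 2" if "h \<in> H - {id}" "h \<in> G" for h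
    using two that by auto
  have "P = (\<Union>h\<in>G - {id}. {x. h x = x})" using free GH by (auto simp: P_def)
  moreover have "finite {x. h x = x}" if "h \<in> G - {id}" for h
    using two[of h] that by (auto intro: card_ge_0_finite)
  ultimately have finP: "finite P" using finite_subset[OF GH fin] by auto
  have stab: "card (stabilizer_of H x) = Suc (s x)" for x
  proof -
    have "stabilizer_of H x = insert id {h \<in> H - {id}. h x = x}"
      using transformation_groupD(1)[OF H] by auto
    then show ?thesis using fin by (simp add: s_def)
  qed
  have spos: "s x > 0" if "x \<in> P" for x
    using that fin by (auto simp: s_def P_def card_gt_0_iff)
  have os: "card (orbit_of H x) * Suc (s x) = card H" for x
    using orbit_stabilizer[OF H fin, of x] stab by simp
  have s_const: "s y = s x" if "y \<in> orbit_of H x" for x y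
  proof -
    have "card (orbit_of H x) * Suc (s y) = card (orbit_of H x) * Suc (s x)"
      using os[of x] os[of y] orbit_of_eq[OF H that] by simp
    moreover have "card (orbit_of H x) > 0"
      using fin transformation_groupD(1)[OF H] by (auto simp: card_gt_0_iff)
    ultimately show ?thesis by simp
  qed
  have orbP: "orbit_of H x \<subseteq> P" if "x \<in> P" for x
  proof
    fix y assume y: "y \<in> orbit_of H x"
    have "s y > 0" using s_const[OF y] spos[OF that] by simp
    then show "y \<in> P" unfolding s_def by (auto simp: P_def card_gt_0_iff)
  qed
  have osum: "sum s (orbit_of H x) = card (orbit_of H x) * s x" for x
    using s_const by simp
  \<comment> \<open>Count the pairs of a non-identity element and a fixed point of it in two ways.\<close>
  have "sum s P = (\<Sum>x\<in>P. \<Sum>h | h \<in> H - {id} \<and> h x = x. 1::nat)"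
    by (simp add: s_def)
  also have "\<dots> = (\<Sum>h\<in>H - {id}. \<Sum>x | x \<in> P \<and> h x = x. 1::nat)"
    using finP fin by (intro sum.swap_restrict) auto
  also have "\<dots> = (\<Sum>h\<in>H - {id}. if h \<in> G then 2 else 0)"
  proof (rule sum.cong[OF refl])
    fix h assume h: "h \<in> H - {id}"
    have *: "{x \<in> P. h x = x} = {x. h x = x}" using h by (auto simp: P_def)
    show "(\<Sum>x | x \<in> P \<and> h x = x. 1::nat) = (if h \<in> G then 2 else 0)"
      using two'[OF h] free[of h] h by (auto simp: *)
  qed
  also have "\<dots> = (\<Sum>h\<in>G - {id}. 2)"
    using fin GH by (intro sum.mono_neutral_cong_right) auto
  also have "\<dots> = card H - 2"
    using half finite_subset[OF GH fin] idG by (simp add: card_Diff_singleton)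
  finally have total: "sum s P = card H - 2" .
  have Gpos: "card G > 0" using idG finite_subset[OF GH fin] by (auto simp: card_gt_0_iff)
  have pP: "p \<in> P" using nontriv GH by (auto simp: P_def)
  have "P = orbit_of H p"
  proof (rule ccontr)
    assume "P \<noteq> orbit_of H p"
    then obtain p' where p': "p' \<in> P" "p' \<notin> orbit_of H p" using orbP[OF pP] by blast
    have self: "x \<in> orbit_of H x" for x
      by (rule image_eqI[of _ _ id]) (use transformation_groupD(1)[OF H] in auto)
    have disj: "orbit_of H p \<inter> orbit_of H p' = {}"
    proof (rule ccontr)
      assume "\<not> ?thesis"
      then obtain y where "y \<in> orbit_of H p" "y \<in> orbit_of H p'" by blast
      then have "orbit_of H p' = orbit_of H p" using orbit_of_eq[OF H, of y] by metis
      with p'(2) self[of p'] show False by simp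
    qed
    have "sum s (orbit_of H p) + sum s (orbit_of H p') = sum s (orbit_of H p \<union> orbit_of H p')"
      using fin disj by (simp add: sum.union_disjoint)
    also have "\<dots> \<le> sum s P"
      using orbP[OF pP] orbP[OF p'(1)] finP by (intro sum_mono2) auto
    finally have le: "sum s (orbit_of H p) + sum s (orbit_of H p') \<le> sum s P" .
    \<comment> \<open>With \<open>r = s x + 1 \<ge> 2\<close> the orbit has \<open>card H / r\<close> points, and \<open>(r - 1) / r \<ge> 1 / 2\<close>.\<close>
    have big: "card H \<le> 2 * sum s (orbit_of H x)" if "x \<in> P" for x
    proof -
      have "card (orbit_of H x) \<le> card (orbit_of H x) * s x" using spos[OF that] by simp
      then show ?thesis using os[of x] osum[of x] unfolding mult_Suc_right by linarith
    qed
    show False using le total big[OF pP] big[OF p'(1)] Gpos half by linarith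
  qed
  \<comment> \<open>Comparison with \<open>card (orbit_of H p) * (s p + 1) = card H\<close> shows that the orbit has two points.\<close>
  then have "card (orbit_of H p) * s p = card H - 2" using total osum[of p] by simp
  with os[of p] Gpos half have "card (orbit_of H p) = 2" by simp
  with os[of p] stab[of p] half have "card (stabilizer_of H p) = card G" by simp
  moreover have "stabilizer_of H p \<subseteq> G" using free by auto
  ultimately have "stabilizer_of H p = G"
    using finite_subset[OF GH fin] by (intro card_subset_eq) auto
  with g show ?thesis by auto
qed

section \<open>Moebius transformations and extended Moebius transformations\<close>

lemma PSL2C_comp: "S \<in> carrier PSL2C \<Longrightarrow> T \<in> carrier PSL2C \<Longrightarrow> S \<circ> T \<in> carrier PSL2C"
  using monoid.m_closed[OF group.is_monoid[OF group_PSL2C], of S T] by (simp add: PSL2C_def)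

lemma id_in_PSL2C: "id \<in> carrier PSL2C"
  using monoid.one_closed[OF group.is_monoid[OF group_PSL2C]] by (simp add: PSL2C_def)

lemma PSL2C_inverse:
  assumes "T \<in> carrier PSL2C"
  obtains S where "S \<in> carrier PSL2C" "S \<circ> T = id" "T \<circ> S = id"
proof
  show "inv\<^bsub>PSL2C\<^esub> T \<in> carrier PSL2C" by (rule group.inv_closed[OF group_PSL2C assms])
  show "inv\<^bsub>PSL2C\<^esub> T \<circ> T = id" "T \<circ> inv\<^bsub>PSL2C\<^esub> T = id"
    using group.l_inv[OF group_PSL2C assms] group.r_inv[OF group_PSL2C assms]
    by (simp_all add: PSL2C_def)
qed

lemma PSL2CE:
  assumes "T \<in> carrier PSL2C"
  obtains a b c d where "T = moebius a b c d" "a * d - b * c = 1"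
  using assms by (auto simp: PSL2C_def)

lemma PSL2CI: "a * d - b * c = 1 \<Longrightarrow> moebius a b c d \<in> carrier PSL2C"
  by (auto simp: PSL2C_def)

lemma conj_map_invol: "conj_map \<circ> conj_map = id"
  by (auto simp: conj_map_def option.map_comp fun_eq_iff option.map_ident comp_def)

lemma conj_map_moebius:
  "conj_map \<circ> moebius a b c d = moebius (cnj a) (cnj b) (cnj c) (cnj d) \<circ> conj_map"
proof -
  have "cnj c * cnj w + cnj d = 0 \<longleftrightarrow> c * w + d = 0" for w
    by (metis complex_cnj_add complex_cnj_mult complex_cnj_zero_iff)
  then show ?thesis
    by (auto simp: fun_eq_iff conj_map_def moebius_def split: option.split)
qed

lemma conj_map_PSL2C:
  assumes "T \<in> carrier PSL2C"
  obtains S where "S \<in> carrier PSL2C" "conj_map \<circ> T = S \<circ> conj_map"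
proof -
  obtain a b c d where T: "T = moebius a b c d" "a * d - b * c = 1" by (rule PSL2CE[OF assms])
  have "cnj a * cnj d - cnj b * cnj c = 1"
    using arg_cong[OF T(2), of cnj] by simp
  with T show ?thesis by (intro that[OF PSL2CI]) (auto simp: conj_map_moebius)
qed

lemma extended_moebiusI: "T \<in> carrier PSL2C \<Longrightarrow> T \<circ> conj_map \<in> extended_moebius"
  by (auto simp: extended_moebius_def)

lemma PSL2C_comp_extended:
  "S \<in> carrier PSL2C \<Longrightarrow> Q \<in> extended_moebius \<Longrightarrow> S \<circ> Q \<in> extended_moebius"
  unfolding extended_moebius_def by (auto simp flip: comp_assoc intro: PSL2C_comp)

lemma extended_comp_PSL2C:
  assumes "Q \<in> extended_moebius" "S \<in> carrier PSL2C"
  shows "Q \<circ> S \<in> extended_moebius"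
proof -
  obtain T where T: "T \<in> carrier PSL2C" "Q = T \<circ> conj_map"
    using assms(1) by (auto simp: extended_moebius_def)
  obtain S' where S': "S' \<in> carrier PSL2C" "conj_map \<circ> S = S' \<circ> conj_map"
    by (rule conj_map_PSL2C[OF assms(2)])
  have "Q \<circ> S = (T \<circ> S') \<circ> conj_map" using T(2) S'(2) by (metis comp_assoc)
  then show ?thesis using extended_moebiusI[OF PSL2C_comp[OF T(1) S'(1)]] by simp
qed

lemma extended_comp_extended:
  assumes "Q \<in> extended_moebius" "R \<in> extended_moebius"
  shows "Q \<circ> R \<in> carrier PSL2C"
proof -
  obtain T where T: "T \<in> carrier PSL2C" "R = T \<circ> conj_map"
    using assms(2) by (auto simp: extended_moebius_def)
  obtain U where U: "U \<in> carrier PSL2C" "Q \<circ> T = U \<circ> conj_map"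
    using extended_comp_PSL2C[OF assms(1) T(1)] by (auto simp: extended_moebius_def)
  have "Q \<circ> R = U" using T(2) U(2) conj_map_invol by (metis comp_assoc comp_id)
  with U show ?thesis by simp
qed

lemma extended_inverse:
  assumes "Q \<in> extended_moebius"
  obtains R where "R \<in> extended_moebius" "R \<circ> Q = id" "Q \<circ> R = id"
proof -
  obtain T where T: "T \<in> carrier PSL2C" "Q = T \<circ> conj_map"
    using assms by (auto simp: extended_moebius_def)
  obtain S where S: "S \<in> carrier PSL2C" "S \<circ> T = id" "T \<circ> S = id" by (rule PSL2C_inverse[OF T(1)])
  have "id \<circ> conj_map \<in> extended_moebius" by (rule extended_moebiusI[OF id_in_PSL2C])
  then have "conj_map \<circ> S \<in> extended_moebius" using extended_comp_PSL2C[OF _ S(1)] by simp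
  moreover have "(conj_map \<circ> S) \<circ> Q = id" "Q \<circ> (conj_map \<circ> S) = id"
    using S T(2) conj_map_invol by (metis comp_assoc comp_id)+
  ultimately show ?thesis by (rule that)
qed

text \<open>A fixed point can be placed at infinity; all the fixed point arguments below reduce in this way
  to affine maps.\<close>

lemma PSL2C_move_to_infinity:
  obtains S where "S \<in> carrier PSL2C" "S p = None"
proof (cases p)
  case None
  then show ?thesis using that[OF id_in_PSL2C] by simp
next
  case (Some w)
  show ?thesis
    by (rule that[of "moebius 0 (-1) 1 (- w)"]) (auto intro: PSL2CI simp: Some moebius_def)
qed

definition affine_map :: "complex \<Rightarrow> complex \<Rightarrow> sphere \<Rightarrow> sphere" where
  "affine_map a b = map_option (\<lambda>z. a * z + b)"

lemma affine_map_simps [simp]: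
  "affine_map a b None = None" "affine_map a b (Some z) = Some (a * z + b)"
  by (simp_all add: affine_map_def)

lemma affine_map_eq_iff [simp]: "affine_map a b = affine_map a' b' \<longleftrightarrow> a = a' \<and> b = b'"
proof
  assume *: "affine_map a b = affine_map a' b'"
  show "a = a' \<and> b = b'" using fun_cong[OF *, of "Some 0"] fun_cong[OF *, of "Some 1"] by simp
qed simp

lemma affine_map_id: "affine_map 1 0 = id"
  by (auto simp: affine_map_def fun_eq_iff option.map_ident)

lemma affine_map_comp: "affine_map a b \<circ> affine_map a' b' = affine_map (a * a') (a * b' + b)"
  by (auto simp: affine_map_def fun_eq_iff option.map_comp comp_def algebra_simps)

lemma affine_map_funpow: "\<exists>b'. affine_map a b ^^ n = affine_map (a ^ n) b'"
proof (induction n)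
  case 0
  show ?case using affine_map_id by (intro exI[of _ 0]) (auto simp: id_def)
next
  case (Suc n)
  then obtain b' where "affine_map a b ^^ n = affine_map (a ^ n) b'" by auto
  then show ?case by (auto simp: affine_map_comp)
qed

lemma translation_funpow: "affine_map 1 b ^^ n = affine_map 1 (of_nat n * b)"
proof (induction n)
  case 0
  show ?case using affine_map_id by (simp add: id_def)
next
  case (Suc n)
  then show ?case by (simp add: affine_map_comp algebra_simps)
qed

text \<open>An affine map of finite order is a rotation or the identity: the multiplier is a root of unity,
  and a nonzero translation has infinite order.\<close>

lemma affine_map_finite_order:
  assumes "affine_map a b ^^ n = id" "n > 0"
  shows "a ^ n = 1" "a = 1 \<Longrightarrow> b = 0"
proof -
  show "a ^ n = 1" using affine_map_funpow[where a=a and b=b and n=n] assms(1)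
    by (auto simp flip: affine_map_id)
  show "b = 0" if "a = 1"
    using translation_funpow[where b=b and n=n] assms that by (simp flip: affine_map_id)
qed

lemma PSL2C_fixing_infinity:
  assumes "T \<in> carrier PSL2C" "T None = None"
  obtains a b where "a \<noteq> 0" "T = affine_map a b"
proof -
  obtain a b c d where T: "T = moebius a b c d" "a * d - b * c = 1" by (rule PSL2CE[OF assms(1)])
  have c: "c = 0" using assms(2) T(1) by (auto simp: moebius_def split: if_splits)
  then have nz: "a \<noteq> 0" "d \<noteq> 0" using T(2) by auto
  have "T = affine_map (a / d) (b / d)"
    using nz c by (auto simp: T(1) moebius_def affine_map_def fun_eq_iff field_simps split: option.split)
  with nz show ?thesis by (intro that) auto
qed

text \<open>The fixed point equation is the quadratic \<open>c * w\<^sup>2 + (d - a) * w - b = 0\<close>, unless infinity is fixed.\<close>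

lemma PSL2C_has_fixed_point:
  assumes "T \<in> carrier PSL2C"
  shows "\<exists>p. T p = p"
proof -
  obtain a b c d where T: "T = moebius a b c d" "a * d - b * c = 1" by (rule PSL2CE[OF assms(1)])
  show ?thesis
  proof (cases "c = 0")
    case True
    then show ?thesis by (intro exI[of _ None]) (simp add: T(1) moebius_def)
  next
    case False
    define s where "s = csqrt ((a - d)\<^sup>2 + 4 * b * c)"
    define w where "w = (a - d + s) / (2 * c)"
    have s2: "s\<^sup>2 = (a - d)\<^sup>2 + 4 * b * c" by (simp add: s_def)
    have "2 * c * w = a - d + s" using False by (simp add: w_def)
    then have "s = 2 * c * w - (a - d)" by simp
    then have "(2 * c * w - (a - d))\<^sup>2 = (a - d)\<^sup>2 + 4 * b * c" using s2 by simp
    then have "4 * c * (w * (c * w + d) - (a * w + b)) = 0"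
      by (simp add: power2_eq_square algebra_simps)
    then have fixed: "a * w + b = w * (c * w + d)" using False by simp
    have "c * w + d \<noteq> 0"
    proof
      assume "c * w + d = 0"
      with fixed have "d = - c * w" "b = - a * w" by (simp_all add: eq_neg_iff_add_eq_0 add.commute)
      with T(2) show False by simp
    qed
    with fixed have "T (Some w) = Some w" by (simp add: T(1) moebius_def)
    then show ?thesis by blast
  qed
qed

lemma funpow_conjugate:
  assumes "S' \<circ> S = id"
  shows "(S \<circ> T \<circ> S') ^^ n \<circ> S = S \<circ> T ^^ n"
proof (induction n)
  case 0
  show ?case by (simp add: fun_eq_iff)
next
  case (Suc n)
  have "(S \<circ> T \<circ> S') ^^ Suc n \<circ> S = S \<circ> T \<circ> S' \<circ> ((S \<circ> T \<circ> S') ^^ n \<circ> S)"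
    by (simp only: funpow.simps comp_assoc)
  also have "\<dots> = S \<circ> T \<circ> (S' \<circ> S) \<circ> T ^^ n"
    unfolding Suc by (simp only: comp_assoc)
  also have "\<dots> = S \<circ> T ^^ Suc n" by (simp only: assms funpow.simps comp_id comp_assoc)
  finally show ?case .
qed

lemma funpow_conjugate_id:
  assumes "S' \<circ> S = id" "S \<circ> S' = id" "T ^^ n = id"
  shows "(S \<circ> T \<circ> S') ^^ n = id"
  using funpow_conjugate[OF assms(1), where T = T and n = n] assms(2,3) by (metis comp_assoc comp_id id_comp)

text \<open>The map \<open>S'\<close> is kept as a separate variable with \<open>S' \<circ> S = id\<close>, so that the same conjugation can
  be used for several transformations with the fixed point \<open>p\<close>.\<close>

lemma PSL2C_normal_form:
  assumes "T \<in> carrier PSL2C" "T p = p" "S \<in> carrier PSL2C" "S p = None"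
    "S' \<in> carrier PSL2C" "S' \<circ> S = id"
  obtains a b where "a \<noteq> 0" "S \<circ> T \<circ> S' = affine_map a b"
proof -
  have "S' None = p" using assms(4,6) by (metis comp_apply id_apply)
  with assms(2,4) have inf: "(S \<circ> T \<circ> S') None = None" by simp
  have "S \<circ> T \<circ> S' \<in> carrier PSL2C" by (intro PSL2C_comp assms)
  from PSL2C_fixing_infinity[OF this inf] show ?thesis using that by blast
qed

text \<open>With one fixed point at infinity the map is \<open>z \<mapsto> a * z + b\<close>. Finite order excludes translations,
  so \<open>a \<noteq> 1\<close>, and \<open>b / (1 - a)\<close> is the second fixed point.\<close>

lemma PSL2C_finite_order_two_fixed_points:
  assumes T: "T \<in> carrier PSL2C" "T \<noteq> id" and n: "n > 0" "T ^^ n = id"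
  shows "card {x. T x = x} = 2"
proof -
  obtain p where p: "T p = p" using PSL2C_has_fixed_point[OF T(1)] by blast
  obtain S where S: "S \<in> carrier PSL2C" "S p = None" by (rule PSL2C_move_to_infinity)
  obtain S' where S': "S' \<in> carrier PSL2C" "S' \<circ> S = id" "S \<circ> S' = id"
    by (rule PSL2C_inverse[OF S(1)])
  obtain a b where ab: "S \<circ> T \<circ> S' = affine_map a b"
    by (rule PSL2C_normal_form[OF T(1) p S S'(1,2)])
  have S'S: "S' (S x) = x" "S (S' x) = x" for x using S' by (metis comp_apply id_apply)+
  have Teq: "T x = S' (affine_map a b (S x))" for x by (simp flip: ab add: S'S)
  have ord: "a = 1 \<Longrightarrow> b = 0"
    using affine_map_finite_order(2)[OF _ n(1), of a b] funpow_conjugate_id[OF S'(2,3) n(2)] ab by simp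
  have "a \<noteq> 1"
  proof
    assume "a = 1"
    with ord have "affine_map a b = id" using affine_map_id by simp
    then have "T = id" using Teq S'S by (auto simp: fun_eq_iff)
    with T(2) show False by simp
  qed
  have "{y. affine_map a b y = y} = {None, Some (b / (1 - a))}" (is "?A = ?B")
  proof (rule Set.set_eqI)
    fix y show "y \<in> ?A \<longleftrightarrow> y \<in> ?B"
      using \<open>a \<noteq> 1\<close> by (cases y) (auto simp: field_simps)
  qed
  then have "card {y. affine_map a b y = y} = 2" by simp
  moreover have "{x. T x = x} = S' ` {y. affine_map a b y = y}"
  proof -
    have "T x = x \<longleftrightarrow> affine_map a b (S x) = S x" for x by (metis Teq S'S)
    moreover have "x \<in> S' ` A \<longleftrightarrow> S x \<in> A" for x and A :: "sphere set"
      using S'S by (metis image_iff)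
    ultimately show ?thesis by (intro Set.set_eqI) (simp only: mem_Collect_eq)
  qed
  moreover have "inj S'" using S'S by (metis injI)
  ultimately show ?thesis by (simp add: card_image inj_on_subset)
qed

text \<open>With the fixed point at infinity \<open>Q\<close> becomes \<open>z \<mapsto> a * cnj z + b\<close>, whose square has the multiplier
  \<open>a * cnj a\<close>. This is a nonnegative real number, and the only such number that is a root of unity is
  1; so the square is a translation of finite order, that is, the identity.\<close>

lemma extended_moebius_fixed_point_reflection:
  assumes Q: "Q \<in> extended_moebius" "Q p = p" and n: "n > 0" "(Q \<circ> Q) ^^ n = id"
  shows "is_reflection Q"
proof -
  obtain S where S: "S \<in> carrier PSL2C" "S p = None" by (rule PSL2C_move_to_infinity)
  obtain S' where S': "S' \<in> carrier PSL2C" "S' \<circ> S = id" "S \<circ> S' = id"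
    by (rule PSL2C_inverse[OF S(1)])
  have S'S: "S' (S x) = x" "S (S' x) = x" for x using S' by (metis comp_apply id_apply)+
  have "S \<circ> Q \<circ> S' \<in> extended_moebius"
    by (intro extended_comp_PSL2C PSL2C_comp_extended S S' Q)
  then obtain T where T: "T \<in> carrier PSL2C" "S \<circ> Q \<circ> S' = T \<circ> conj_map"
    by (auto simp: extended_moebius_def)
  have "S' None = p" using S(2) S'S(1)[of p] by simp
  then have "T None = None"
    using fun_cong[OF T(2), of None] Q(2) S(2) by (simp add: conj_map_def)
  then obtain a b where ab: "T = affine_map a b" by (rule PSL2C_fixing_infinity[OF T(1)])
  have "S \<circ> (Q \<circ> Q) \<circ> S' = (S \<circ> Q \<circ> S') \<circ> (S \<circ> Q \<circ> S')" by (simp add: fun_eq_iff S'S)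
  also have "\<dots> = affine_map (a * cnj a) (a * cnj b + b)"
    unfolding T(2) ab
    by (auto simp: fun_eq_iff affine_map_def conj_map_def option.map_comp comp_def algebra_simps)
  finally have QQ: "S \<circ> (Q \<circ> Q) \<circ> S' = affine_map (a * cnj a) (a * cnj b + b)" .
  have "affine_map (a * cnj a) (a * cnj b + b) ^^ n = id"
    using funpow_conjugate_id[OF S'(2,3) n(2)] QQ by simp
  note ord = affine_map_finite_order[OF this n(1)]
  have aa: "a * cnj a = of_real ((cmod a)\<^sup>2)" by (rule complex_norm_square[symmetric])
  then have "((cmod a)\<^sup>2) ^ n = 1"
    using ord(1) by (metis of_real_1 of_real_eq_iff of_real_power)
  then have "(cmod a)\<^sup>2 = 1" using n(1) by (metis power_eq_1_iff zero_le_power2 neq0_conv abs_of_nonneg real_norm_def)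
  with aa have "a * cnj a = 1" by simp
  with ord(2) have "S \<circ> (Q \<circ> Q) \<circ> S' = id" using QQ affine_map_id by simp
  then have "Q (Q x) = x" for x using S'S by (metis comp_apply id_apply)
  then show ?thesis using Q by (auto simp: is_reflection_def fun_eq_iff)
qed

text \<open>The quotient of the two maps fixes three points. With one of them at infinity it is affine with
  two finite fixed points, hence the identity.\<close>

lemma PSL2C_determined_by_three_points:
  assumes S: "S \<in> carrier PSL2C" and T: "T \<in> carrier PSL2C"
    and F: "3 \<le> card F" and eq: "\<And>x. x \<in> F \<Longrightarrow> S x = T x"
  shows "S = T"
proof -
  obtain R where R: "R \<in> carrier PSL2C" "R \<circ> S = id" "S \<circ> R = id" by (rule PSL2C_inverse[OF S])
  have RT: "R \<circ> T \<in> carrier PSL2C" by (rule PSL2C_comp[OF R(1) T])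
  have fixF: "(R \<circ> T) x = x" if "x \<in> F" for x
    using eq[OF that] R(2) by (metis comp_apply id_apply)
  obtain p where p: "p \<in> F" using F by fastforce
  obtain V where V: "V \<in> carrier PSL2C" "V p = None" by (rule PSL2C_move_to_infinity)
  obtain V' where V': "V' \<in> carrier PSL2C" "V' \<circ> V = id" "V \<circ> V' = id"
    by (rule PSL2C_inverse[OF V(1)])
  have V'V: "V' (V x) = x" "V (V' x) = x" for x using V' by (metis comp_apply id_apply)+
  obtain a b where ab: "V \<circ> (R \<circ> T) \<circ> V' = affine_map a b"
    by (rule PSL2C_normal_form[OF RT fixF[OF p] V V'(1,2)])
  have card2: "2 \<le> card (F - {p})" using F p by simp
  then have "finite (F - {p})" by (metis card.infinite not_numeral_le_zero)
  with card2 have "\<not> (\<forall>x\<in>F - {p}. \<forall>y\<in>F - {p}. x = y)"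
    by (subst card_le_Suc0_iff_eq[symmetric]) auto
  then obtain x y where xy: "x \<in> F - {p}" "y \<in> F - {p}" "x \<noteq> y" by blast
  have fixed: "affine_map a b (V z) = V z" if "z \<in> F" for z
    using fixF[OF that] by (simp flip: ab add: V'V)
  have finite_value: "\<exists>u. V z = Some u" if "z \<noteq> p" for z using that V(2) V'V(1) by (metis not_Some_eq)
  obtain u v where uv: "V x = Some u" "V y = Some v" using finite_value xy by blast
  then have fix_uv: "a * u + b = u" "a * v + b = v" using fixed[of x] fixed[of y] xy by simp_all
  have "u \<noteq> v" using uv xy(3) V'V(1) by metis
  have "(a - 1) * (u - v) = (a * u + b - u) - (a * v + b - v)" by (simp add: algebra_simps)
  also have "\<dots> = 0" using fix_uv by simp
  finally have "(a - 1) * (u - v) = 0" .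
  with \<open>u \<noteq> v\<close> fix_uv(1) have "a = 1" "b = 0" by auto
  then have "V \<circ> (R \<circ> T) \<circ> V' = id" using ab affine_map_id by simp
  then have "R \<circ> T = id" using V'V by (metis comp_apply id_apply ext)
  then show ?thesis using R(3) by (metis comp_assoc comp_id id_comp)
qed

text \<open>By \<open>PSL2C_determined_by_three_points\<close> the restriction to \<open>F\<close>, a self-map of a finite set, determines the
  transformation.\<close>

lemma finite_PSL2C_preserving:
  assumes F: "finite F" "3 \<le> card F"
  shows "finite {T \<in> carrier PSL2C. T ` F \<subseteq> F}" (is "finite ?G")
proof -
  have "finite ((\<lambda>T. restrict T F) ` ?G)"
    by (rule finite_subset[OF _ finite_PiE[of F "\<lambda>_. F"]]) (use F in auto)
  moreover have "inj_on (\<lambda>T. restrict T F) ?G"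
  proof (rule inj_onI)
    fix S T assume *: "S \<in> ?G" "T \<in> ?G" "restrict S F = restrict T F"
    then show "S = T"
      using PSL2C_determined_by_three_points[OF _ _ F(2)] by (metis (mono_tags, lifting) mem_Collect_eq restrict_apply')
  qed
  ultimately show ?thesis by (rule finite_imageD)
qed

section \<open>Finite groups of Moebius transformations with a common fixed point\<close>

text \<open>Multiplication by an element \<open>a\<close> of \<open>A\<close> permutes \<open>A\<close>, so comparing the product of all elements
  before and after gives \<open>a ^ card A = 1\<close>. This equation has exactly
  \<open>card A\<close> solutions, so \<open>A\<close> consists of all of them.\<close>

lemma finite_mult_closed_roots_of_unity:
  fixes A :: "complex set"
  assumes fin: "finite A" and ne: "A \<noteq> {}" "0 \<notin> A"
    and closed: "\<And>a b. a \<in> A \<Longrightarrow> b \<in> A \<Longrightarrow> a * b \<in> A"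
  shows "A = {z. z ^ card A = 1}"
proof -
  have pos: "card A > 0" using fin ne by (simp add: card_gt_0_iff)
  have "a ^ card A = 1" if a: "a \<in> A" for a
  proof -
    have "a \<noteq> 0" using a ne by auto
    then have inj: "inj_on ((*) a) A" by (auto simp: inj_on_def)
    have "(*) a ` A = A"
      using closed a fin inj by (intro card_subset_eq) (auto simp: card_image)
    then have "\<Prod>A = (\<Prod>b\<in>A. a * b)"
      using prod.reindex[OF inj, of "\<lambda>x. x"] by simp
    also have "\<dots> = a ^ card A * \<Prod>A" by (simp add: prod.distrib)
    finally show ?thesis using fin ne by auto
  qed
  then show ?thesis
    using pos by (intro card_subset_eq finite_roots_unity) (auto simp: card_roots_unity_eq)
qed

text \<open>With the common fixed point at infinity the group consists of affine maps \<open>z \<mapsto> \<mu> g * z + \<nu> g\<close>. The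
  multiplier \<open>\<mu>\<close> is multiplicative, and it is injective because translations of finite order are
  trivial. With \<open>n\<close> the order of the group, a preimage of a primitive \<open>n\<close>-th root of unity is a
  generator.\<close>

lemma finite_PSL2C_group_fixing_point_cyclic:
  assumes G: "transformation_group G" "finite G" "G \<subseteq> carrier PSL2C"
    and p: "\<And>g. g \<in> G \<Longrightarrow> g p = p"
  shows "\<exists>g0\<in>G. \<forall>g\<in>G. \<exists>k. g = g0 ^^ k"
proof -
  obtain S where S: "S \<in> carrier PSL2C" "S p = None" by (rule PSL2C_move_to_infinity)
  obtain S' where S': "S' \<in> carrier PSL2C" "S' \<circ> S = id" "S \<circ> S' = id"
    by (rule PSL2C_inverse[OF S(1)])
  have S'S: "S' (S x) = x" "S (S' x) = x" for x using S' by (metis comp_apply id_apply)+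
  have "\<exists>a b. a \<noteq> 0 \<and> S \<circ> g \<circ> S' = affine_map a b" if g: "g \<in> G" for g
  proof -
    have "g \<in> carrier PSL2C" using g G(3) by blast
    from PSL2C_normal_form[OF this p[OF g] S S'(1,2)] show ?thesis by metis
  qed
  then obtain \<mu> \<nu> where \<mu>: "\<And>g. g \<in> G \<Longrightarrow> \<mu> g \<noteq> 0"
    "\<And>g. g \<in> G \<Longrightarrow> S \<circ> g \<circ> S' = affine_map (\<mu> g) (\<nu> g)" by metis
  have mult: "\<mu> (g \<circ> h) = \<mu> g * \<mu> h" if "g \<in> G" "h \<in> G" for g h
  proof -
    have "S \<circ> (g \<circ> h) \<circ> S' = (S \<circ> g \<circ> S') \<circ> (S \<circ> h \<circ> S')" by (simp add: fun_eq_iff S'S)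
    then show ?thesis
      using \<mu>(2)[OF that(1)] \<mu>(2)[OF that(2)] \<mu>(2)[OF transformation_groupD(2)[OF G(1) that]]
      by (simp add: affine_map_comp)
  qed
  have \<mu>_id: "\<mu> id = 1"
    using mult[of id id] transformation_groupD(1)[OF G(1)] \<mu>(1)[of id] by (simp only: comp_id) simp
  have kernel: "g = id" if g: "g \<in> G" "\<mu> g = 1" for g
  proof -
    obtain n where n: "n > 0" "g ^^ n = id"
      using finite_transformation_group_order[OF G(1,2) g(1)] by blast
    have "\<nu> g = 0"
      using affine_map_finite_order(2)[OF _ n(1), of "\<mu> g" "\<nu> g"] g
        funpow_conjugate_id[OF S'(2,3) n(2)] \<mu>(2)[OF g(1)] by simp
    then have "S \<circ> g \<circ> S' = id" using \<mu>(2)[OF g(1)] g(2) affine_map_id by simp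
    then show ?thesis using S'S by (metis comp_apply id_apply ext)
  qed
  have inj: "g = h" if gh: "g \<in> G" "h \<in> G" "\<mu> g = \<mu> h" for g h
  proof -
    obtain k where k: "k \<in> G" "k \<circ> h = id" "h \<circ> k = id"
      using transformation_groupD(3)[OF G(1) gh(2)] by blast
    have "\<mu> (k \<circ> g) = \<mu> (k \<circ> h)" using gh k(1) mult by simp
    then have "k \<circ> g = id"
      using kernel transformation_groupD(2)[OF G(1) k(1) gh(1)] k(2) \<mu>_id by simp
    then show ?thesis using k(3) by (metis comp_assoc comp_id id_comp)
  qed
  have A: "\<mu> ` G = {z. z ^ card (\<mu> ` G) = 1}"
    using G(2) transformation_groupD(1,2)[OF G(1)] \<mu>(1) mult
    by (intro finite_mult_closed_roots_of_unity) (auto simp flip: mult)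
  define N where "N = card (\<mu> ` G)"
  have N: "N > 0" using G(2) transformation_groupD(1)[OF G(1)] by (auto simp: N_def card_gt_0_iff)
  have roots: "\<mu> ` G = (\<lambda>k. cis (2 * pi * real k / real N)) ` {..<N}"
    using A bij_betw_roots_unity[OF N] by (simp add: bij_betw_def N_def)
  have "cis (2 * pi / real N) ^ N = 1" using N by (simp add: DeMoivre)
  then have "cis (2 * pi / real N) \<in> \<mu> ` G" using A N_def by blast
  then obtain g0 where g0: "g0 \<in> G" "\<mu> g0 = cis (2 * pi / real N)" by auto
  have pow: "\<mu> (g0 ^^ k) = \<mu> g0 ^ k" for k
  proof (induction k)
    case 0
    show ?case by (simp only: funpow.simps \<mu>_id power_0)
  next
    case (Suc k)
    then show ?case using mult[OF g0(1) transformation_group_funpow[OF G(1) g0(1)]]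
      by (simp only: funpow.simps power_Suc)
  qed
  show ?thesis
  proof (intro bexI[OF _ g0(1)] ballI)
    fix g assume g: "g \<in> G"
    then obtain k where "\<mu> g = cis (2 * pi * real k / real N)" using roots by auto
    then have "\<mu> g = \<mu> (g0 ^^ k)"
      by (simp add: pow g0(2) DeMoivre mult_ac)
    then show "\<exists>k. g = g0 ^^ k"
      using inj[OF g transformation_group_funpow[OF G(1) g0(1)]] by blast
  qed
qed

section \<open>Finite invariant sets of a rational map\<close>

lemma complex_poly_card_simple_roots:
  fixes f :: "complex poly"
  assumes "rsquarefree f"
  shows "card {z. poly f z = 0} = degree f"
proof -
  have nz: "f \<noteq> 0" using assms by (simp add: rsquarefree_def)
  have "degree f = degree (smult (lead_coeff f) (\<Prod>z | poly f z = 0. [:- z, 1:]))"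
    using complex_poly_decompose_rsquarefree[OF assms] by simp
  also have "\<dots> = card {z. poly f z = 0}"
    using nz by (simp add: degree_prod_eq_sum_degree)
  finally show ?thesis by simp
qed

lemma complex_poly_root_exists:
  fixes f :: "complex poly"
  assumes "degree f > 0"
  shows "\<exists>z. poly f z = 0"
  using assms fundamental_theorem_of_algebra[of f] by (auto simp: constant_degree)

text \<open>Polynomials without roots are included: then the degree is 0 and the right side is constant.\<close>

lemma complex_poly_single_root:
  fixes f :: "complex poly"
  assumes "f \<noteq> 0" "\<And>z. poly f z = 0 \<Longrightarrow> z = w"
  shows "f = smult (lead_coeff f) ([:- w, 1:] ^ degree f)"
proof -
  have split: "f = smult (lead_coeff f) (\<Prod>z | poly f z = 0. [:- z, 1:] ^ Polynomial.order z f)"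
    using complex_poly_decompose[of f] by simp
  have "{z. poly f z = 0} = {w} \<or> {z. poly f z = 0} = {}" using assms(2) by auto
  then obtain n where n: "f = smult (lead_coeff f) ([:- w, 1:] ^ n)"
  proof
    assume *: "{z. poly f z = 0} = {w}"
    show ?thesis by (rule that[of "Polynomial.order w f"]) (use split in \<open>simp add: *\<close>)
  next
    assume *: "{z. poly f z = 0} = {}"
    show ?thesis by (rule that[of 0]) (use split in \<open>simp add: *\<close>)
  qed
  have "degree f = n"
    using arg_cong[OF n, of degree] assms(1) by (simp add: degree_power_eq)
  with n show ?thesis by simp
qed

lemma degree_diff_eq_right:
  fixes f g :: "'a::ab_group_add poly"
  assumes "degree f < degree g"
  shows "degree (f - g) = degree g"
  using degree_add_eq_right[of f "- g"] assms by simp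

lemma degree_diff_eq_left:
  fixes f g :: "'a::ab_group_add poly"
  assumes "degree g < degree f"
  shows "degree (f - g) = degree f"
  using degree_add_eq_left[of "- g" f] assms by simp

text \<open>The coprime pair \<open>p\<close>, \<open>q\<close> is treated as a pair of forms of degree \<open>d\<close>: the fibre over a
  finite value \<open>c\<close> consists of the roots of \<open>p - c * q\<close>, together with infinity if the coefficient of
  this polynomial at \<open>d\<close> vanishes, and the fibre over infinity is described by \<open>q\<close> in the same way.\<close>

context
  fixes p q :: "complex poly" and d :: nat
  assumes cop: "coprime p q" and deg: "max (degree p) (degree q) = d" and d: "d \<ge> 2"
begin

private abbreviation "\<phi> \<equiv> rat_map p q"

private lemma no_common_root: "poly p w \<noteq> 0 \<or> poly q w \<noteq> 0"
proof (rule ccontr)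
  assume "\<not> ?thesis"
  then have "[:- w, 1:] dvd p" "[:- w, 1:] dvd q" by (auto simp: poly_eq_0_iff_dvd)
  then have "is_unit [:- w, 1:]" using cop by (metis coprime_common_divisor)
  then show False by (auto simp: is_unit_pCons_iff)
qed

private lemma top_coeff: "coeff p d \<noteq> 0 \<or> coeff q d \<noteq> 0"
proof -
  have "degree p = d \<or> degree q = d" using deg by (auto simp: max_def split: if_splits)
  then show ?thesis using d by (metis degree_0 leading_coeff_0_iff not_numeral_le_zero)
qed

private lemma degrees: "degree p \<le> d" "degree q \<le> d"
  using deg by auto

private lemma degree_p: "coeff q d = 0 \<Longrightarrow> degree p = d"
  using top_coeff degrees by (metis le_antisym le_degree)

private lemma degree_q: "coeff q d \<noteq> 0 \<Longrightarrow> degree q = d"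
  using degrees by (metis le_antisym le_degree)

private lemma value_None: "\<phi> None = (if coeff q d = 0 then None else Some (coeff p d / coeff q d))"
  by (simp add: rat_map_def deg Let_def)

private lemma value_None_eq: "\<phi> None = Some c \<longleftrightarrow> coeff (p - smult c q) d = 0"
  using top_coeff by (auto simp: value_None field_simps)

private lemma value_Some_eq: "\<phi> (Some w) = Some c \<longleftrightarrow> poly (p - smult c q) w = 0"
  using no_common_root[of w] by (auto simp: rat_map_def field_simps)

private lemma value_Some_None: "\<phi> (Some w) = None \<longleftrightarrow> poly q w = 0"
  by (auto simp: rat_map_def)

private lemma q_nz: "q \<noteq> 0"
proof
  assume "q = 0"
  with cop have "is_unit p" by simp
  moreover have "p \<noteq> 0" "degree p = d" using \<open>q = 0\<close> deg d by auto
  ultimately show False using d by (simp add: is_unit_iff_degree)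
qed

private lemma fibre_poly_nz: "p - smult c q \<noteq> 0"
proof
  assume *: "p - smult c q = 0"
  then have "q dvd p" by (simp add: dvd_smult)
  then have "is_unit q" using cop by (metis coprime_common_divisor dvd_refl)
  then have "degree q = 0" using q_nz by (simp add: is_unit_iff_degree)
  moreover have "degree p \<le> degree q" using * degree_smult_le[of c q] by simp
  ultimately show False using deg d by simp
qed

lemma rat_map_surj: "surj \<phi>"
proof -
  have "\<exists>z. \<phi> z = v" for v
  proof (cases v)
    case None
    show ?thesis
    proof (cases "coeff q d = 0")
      case True
      then show ?thesis using None value_None by auto
    next
      case False
      then have "degree q > 0" using degree_q d by simp
      then show ?thesis using complex_poly_root_exists value_Some_None None by blast
    qed
  next
    case (Some c)
    show ?thesis
    proof (cases "coeff (p - smult c q) d = 0")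
      case True
      then show ?thesis using Some value_None_eq by auto
    next
      case False
      then have "degree (p - smult c q) > 0" using d le_degree by fastforce
      then show ?thesis using complex_poly_root_exists value_Some_eq Some by blast
    qed
  qed
  then show ?thesis by (metis surjI)
qed

lemma rat_map_finite_fibre: "finite (\<phi> -` {v})"
proof -
  have "finite {w. \<phi> (Some w) = v}"
  proof (cases v)
    case None
    then show ?thesis using poly_roots_finite[OF q_nz] by (simp add: value_Some_None)
  next
    case (Some c)
    then show ?thesis using poly_roots_finite[OF fibre_poly_nz] by (simp add: value_Some_eq)
  qed
  moreover have "\<phi> -` {v} \<subseteq> insert None (Some ` {w. \<phi> (Some w) = v})"
  proof
    fix z assume "z \<in> \<phi> -` {v}"
    then show "z \<in> insert None (Some ` {w. \<phi> (Some w) = v})" by (cases z) auto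
  qed
  ultimately show ?thesis using finite_subset by blast
qed

text \<open>Its roots are the finite fixed points. As a form of degree \<open>d + 1\<close> it also vanishes at infinity when
  infinity is fixed, which shows as a drop of its degree below \<open>d + 1\<close>.\<close>

private definition "fixed_poly = p - [:0, 1:] * q"

private lemma fixed_Some: "\<phi> (Some w) = Some w \<longleftrightarrow> poly fixed_poly w = 0"
  by (simp add: value_Some_eq fixed_poly_def)

private lemma fixed_None: "\<phi> None = None \<longleftrightarrow> coeff q d = 0"
  by (simp add: value_None)

private lemma degree_fixed_poly_None_moves:
  assumes "coeff q d \<noteq> 0"
  shows "degree fixed_poly = Suc d"
proof -
  have "degree ([:0, 1:] * q) = Suc d"
    using degree_q[OF assms] q_nz by (simp add: degree_mult_eq)
  moreover have "degree p < Suc d" using degrees by simp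
  ultimately show ?thesis unfolding fixed_poly_def
    by (simp only: degree_diff_eq_right)
qed

private lemma fixed_poly_nz: "fixed_poly \<noteq> 0"
proof
  assume "fixed_poly = 0"
  then have *: "p = [:0, 1:] * q" by (simp only: fixed_poly_def right_minus_eq)
  then have "q dvd p" by (metis dvd_triv_right)
  then have "is_unit q" using cop by (metis coprime_common_divisor dvd_refl)
  then have "degree q = 0" using q_nz by (simp add: is_unit_iff_degree)
  moreover have "degree p \<le> Suc (degree q)"
    unfolding * by (rule order_trans[OF degree_mult_le]) simp
  ultimately show False using deg d by simp
qed

lemma rat_map_finite_fixed_points: "finite {z. \<phi> z = z}"
proof -
  have "{z. \<phi> z = z} \<subseteq> insert None (Some ` {w. poly fixed_poly w = 0})"
  proof
    fix z assume "z \<in> {z. \<phi> z = z}"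
    then show "z \<in> insert None (Some ` {w. poly fixed_poly w = 0})"
      by (cases z) (auto simp: fixed_Some)
  qed
  then show ?thesis
    using poly_roots_finite[OF fixed_poly_nz] finite_subset by blast
qed

lemma rat_map_fixed_point_exists: "\<exists>z. \<phi> z = z"
proof (cases "coeff q d = 0")
  case True
  then show ?thesis using fixed_None by blast
next
  case False
  then show ?thesis
    using degree_fixed_poly_None_moves complex_poly_root_exists[of fixed_poly] fixed_Some by auto
qed

text \<open>If \<open>w\<close> is its own only preimage, then \<open>p - w * q = k * (z - w) ^ d\<close>. Subtracting \<open>(z - w) * q\<close>
  yields the fixed point polynomial \<open>(z - w) * (k * (z - w) ^ (d - 1) - q)\<close>. At \<open>w\<close> the second
  factor has the value \<open>- poly q w\<close>, because \<open>d \<ge> 2\<close>, and this is nonzero since \<open>\<phi>\<close> is finite there.\<close>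

private lemma exceptional_simple_root:
  assumes "\<phi> -` {Some w} = {Some w}"
  shows "Polynomial.order w fixed_poly = 1"
proof -
  let ?f = "p - smult w q"
  have lc: "coeff ?f d \<noteq> 0" using assms value_None_eq[of w] by auto
  have "degree ?f \<le> d"
    using degrees degree_smult_le[of w q] by (intro degree_diff_le) auto
  then have degf: "degree ?f = d" using le_degree[OF lc] by simp
  have "?f = smult (lead_coeff ?f) ([:- w, 1:] ^ degree ?f)"
    using assms value_Some_eq by (intro complex_poly_single_root[OF fibre_poly_nz]) auto
  then have f: "?f = smult (coeff ?f d) ([:- w, 1:] ^ d)" by (simp only: degf)
  obtain e where e: "d = Suc (Suc e)" using d by (metis add_2_eq_Suc le_Suc_ex)
  define h where "h = smult (coeff ?f d) ([:- w, 1:] ^ Suc e) - q"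
  have "fixed_poly = ?f - [:- w, 1:] * q"
    by (simp add: fixed_poly_def algebra_simps smult_add_left)
  also have "\<dots> = [:- w, 1:] * h"
    by (subst f) (simp only: h_def e power_Suc mult_smult_right right_diff_distrib)
  finally have fp: "fixed_poly = [:- w, 1:] * h" .
  have "\<phi> (Some w) \<noteq> None" using assms by auto
  then have "poly h w \<noteq> 0" by (simp add: h_def value_Some_None)
  moreover have "Polynomial.order w [:- w, 1:] = 1" using order_power_n_n[of w 1] by simp
  moreover have "[:- w, 1:] * h \<noteq> 0" using fixed_poly_nz fp by metis
  ultimately show ?thesis using order_mult[of "[:- w, 1:]" h w] by (simp add: fp order_0I)
qed

text \<open>The counterpart at infinity: the degree drops by exactly one, so that infinity is a simple zero of
  the fixed point form. Here \<open>\<phi>\<close> is a polynomial map, as \<open>q\<close> has no roots.\<close>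

private lemma exceptional_degree:
  assumes "\<phi> -` {None} = {None}"
  shows "degree fixed_poly = d"
proof -
  have q0: "degree q = 0"
  proof (rule ccontr)
    assume "degree q \<noteq> 0"
    then obtain w where "poly q w = 0" using complex_poly_root_exists[of q] by auto
    then have "Some w \<in> \<phi> -` {None}" by (simp add: value_Some_None)
    then have "Some w \<in> {None}" by (simp only: assms)
    then show False by simp
  qed
  have "None \<in> \<phi> -` {None}" by (simp only: assms insertI1)
  then have "coeff q d = 0" by (simp only: vimage_singleton_eq fixed_None)
  then have "degree p = d" by (rule degree_p)
  moreover have "degree ([:0, 1:] * q) < d"
    by (rule le_less_trans[OF degree_mult_le]) (use q0 d in simp)
  ultimately show ?thesis unfolding fixed_poly_def
    by (simp only: degree_diff_eq_left)
qed

text \<open>The fixed points are the zeros of a form of degree \<open>d + 1\<close>, and all of them are simple.\<close>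

lemma card_fixed_points_if_exceptional:
  assumes exc: "\<And>e. \<phi> e = e \<Longrightarrow> \<phi> -` {e} = {e}"
  shows "card {z. \<phi> z = z} = Suc d"
proof -
  have "rsquarefree fixed_poly"
    unfolding rsquarefree_def
  proof (intro conjI allI)
    show "fixed_poly \<noteq> 0" by (rule fixed_poly_nz)
    fix w
    show "Polynomial.order w fixed_poly = 0 \<or> Polynomial.order w fixed_poly = 1"
    proof (cases "poly fixed_poly w = 0")
      case True
      then have "\<phi> (Some w) = Some w" by (simp add: fixed_Some)
      then show ?thesis using exceptional_simple_root[OF exc] by simp
    next
      case False
      then show ?thesis by (simp add: order_0I)
    qed
  qed
  then have c: "card {w. poly fixed_poly w = 0} = degree fixed_poly"
    by (rule complex_poly_card_simple_roots)
  have fin: "finite {w. poly fixed_poly w = 0}" by (rule poly_roots_finite[OF fixed_poly_nz])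
  show ?thesis
  proof (cases "\<phi> None = None")
    case True
    have "{z. \<phi> z = z} = insert None (Some ` {w. poly fixed_poly w = 0})"
      (is "?A = ?B")
    proof (rule Set.set_eqI)
      fix z show "z \<in> ?A \<longleftrightarrow> z \<in> ?B" using True by (cases z) (auto simp: fixed_Some)
    qed
    then show ?thesis
      using c fin exceptional_degree[OF exc[OF True]] by (simp add: card_image)
  next
    case False
    have "{z. \<phi> z = z} = Some ` {w. poly fixed_poly w = 0}" (is "?A = ?B")
    proof (rule Set.set_eqI)
      fix z show "z \<in> ?A \<longleftrightarrow> z \<in> ?B" using False by (cases z) (auto simp: fixed_Some)
    qed
    then show ?thesis
      using c False degree_fixed_poly_None_moves fixed_None by (simp add: card_image)
  qed
qed

text \<open>The sets \<open>F k\<close> of points that \<open>k\<close> iterations bring to a fixed point are finite, increasing, and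
  invariant under everything that commutes with \<open>\<phi>\<close>. If \<open>F 1 = F 0\<close>, each fixed point is its own
  only preimage and there are \<open>d + 1\<close> fixed points. Otherwise some \<open>y\<close> maps to a fixed point without
  being fixed, and a preimage of \<open>y\<close> is a third point of \<open>F 2\<close>.\<close>

lemma rat_map_finite_invariant_set:
  "\<exists>F. finite F \<and> 3 \<le> card F \<and> (\<forall>T. T \<circ> \<phi> = \<phi> \<circ> T \<longrightarrow> T ` F \<subseteq> F)"
proof -
  define F where "F k = (\<phi> ^^ k) -` {z. \<phi> z = z}" for k
  have F_Suc: "F (Suc k) = \<phi> -` F k" for k
    by (auto simp: F_def funpow_swap1)
  have fin: "finite (F k)" for k
  proof (induction k)
    case 0
    then show ?case using rat_map_finite_fixed_points by (simp add: F_def)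
  next
    case (Suc k)
    have "F (Suc k) = (\<Union>v\<in>F k. \<phi> -` {v})" by (auto simp: F_Suc)
    then show ?case using Suc rat_map_finite_fibre by simp
  qed
  have inv: "T ` F k \<subseteq> F k" if "T \<circ> \<phi> = \<phi> \<circ> T" for T k
  proof (induction k)
    case 0
    then show ?case using that by (auto simp: F_def) (metis comp_apply)
  next
    case (Suc k)
    have "\<phi> (T z) = T (\<phi> z)" for z using that by (metis comp_apply)
    then show ?case using Suc by (auto simp: F_Suc)
  qed
  have "3 \<le> card (F 0) \<or> 3 \<le> card (F 2)"
  proof (cases "F 1 = F 0")
    case True
    have "\<phi> -` {e} = {e}" if "\<phi> e = e" for e
    proof -
      have "z = e" if "\<phi> z = e" for z
      proof -
        have "z \<in> F 1" using that \<open>\<phi> e = e\<close> by (simp add: F_def)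
        with True that show ?thesis by (simp add: F_def)
      qed
      with that show ?thesis by auto
    qed
    then have "card (F 0) = Suc d" using card_fixed_points_if_exceptional by (simp add: F_def)
    then show ?thesis using d by simp
  next
    case False
    have "F 0 \<subseteq> F 1" by (auto simp: F_def)
    with False obtain y where y: "\<phi> (\<phi> y) = \<phi> y" "\<phi> y \<noteq> y" by (auto simp: F_def)
    obtain x where x: "\<phi> x = y" using rat_map_surj by (metis surjD)
    have "{\<phi> y, y, x} \<subseteq> F 2" using x y by (auto simp: F_def numeral_2_eq_2)
    then have "card {\<phi> y, y, x} \<le> card (F 2)" by (intro card_mono fin)
    moreover have "\<phi> y \<noteq> x" "y \<noteq> x" using x y by metis+
    then have "card {\<phi> y, y, x} = 3" using y(2) by simp
    ultimately show ?thesis by simp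
  qed
  then show ?thesis using fin inv by metis
qed

end

section \<open>Automorphism groups of rational maps\<close>

text \<open>Commutation with \<open>\<phi>\<close> is the form in which automorphisms compose and act on preimages of fixed
  points.\<close>

lemma Aut_iff: "T \<in> carrier (Aut \<phi>) \<longleftrightarrow> T \<in> carrier PSL2C \<and> T \<circ> \<phi> = \<phi> \<circ> T"
proof (cases "T \<in> carrier PSL2C")
  case True
  obtain S where S: "S \<circ> T = id" "T \<circ> S = id" by (rule PSL2C_inverse[OF True])
  have "inv_into UNIV T = S" by (rule inv_unique_comp[OF S(2,1)])
  then have "T \<circ> \<phi> \<circ> inv_into UNIV T = \<phi> \<longleftrightarrow> T \<circ> \<phi> = \<phi> \<circ> T"
    using S by (metis comp_assoc comp_id)
  with True show ?thesis by (simp add: Aut_def)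
qed (simp add: Aut_def)

lemma antiholo_aut_iff: "Q \<in> antiholo_aut \<phi> \<longleftrightarrow> Q \<in> extended_moebius \<and> Q \<circ> \<phi> = \<phi> \<circ> Q"
proof (cases "Q \<in> extended_moebius")
  case True
  obtain S where S: "S \<circ> Q = id" "Q \<circ> S = id" by (rule extended_inverse[OF True])
  have "inv_into UNIV Q = S" by (rule inv_unique_comp[OF S(2,1)])
  then have "Q \<circ> \<phi> \<circ> inv_into UNIV Q = \<phi> \<longleftrightarrow> Q \<circ> \<phi> = \<phi> \<circ> Q"
    using S by (metis comp_assoc comp_id)
  with True show ?thesis by (simp add: antiholo_aut_def)
qed (simp add: antiholo_aut_def)

lemma finite_Aut:
  assumes "d \<ge> 2" "\<phi> \<in> Rat_maps d"
  shows "finite (carrier (Aut \<phi>))"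
proof -
  obtain p q where pq: "\<phi> = rat_map p q" "coprime p q" "max (degree p) (degree q) = d"
    using assms(2) by (auto simp: Rat_maps_def)
  obtain F where F: "finite F" "3 \<le> card F" "\<And>T. T \<circ> \<phi> = \<phi> \<circ> T \<Longrightarrow> T ` F \<subseteq> F"
    using rat_map_finite_invariant_set[OF pq(2,3) assms(1)] pq(1) by blast
  have "carrier (Aut \<phi>) \<subseteq> {T \<in> carrier PSL2C. T ` F \<subseteq> F}"
  proof
    fix T assume "T \<in> carrier (Aut \<phi>)"
    then have "T \<in> carrier PSL2C" "T \<circ> \<phi> = \<phi> \<circ> T" by (simp_all only: Aut_iff)
    then show "T \<in> {T \<in> carrier PSL2C. T ` F \<subseteq> F}" using F(3) by blast
  qed
  then show ?thesis by (rule finite_subset[OF _ finite_PSL2C_preserving[OF F(1,2)]])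
qed

lemma commuting_inverse:
  assumes "T \<circ> \<phi> = \<phi> \<circ> T" "S \<circ> T = id" "T \<circ> S = id"
  shows "S \<circ> \<phi> = \<phi> \<circ> S"
  using assms by (metis comp_assoc comp_id id_comp)

lemma commuting_comp:
  assumes "S \<circ> \<phi> = \<phi> \<circ> S" "T \<circ> \<phi> = \<phi> \<circ> T"
  shows "S \<circ> T \<circ> \<phi> = \<phi> \<circ> (S \<circ> T)"
  using assms by (metis comp_assoc)

lemma transformation_group_Aut: "transformation_group (carrier (Aut \<phi>))"
  unfolding transformation_group_def
proof (intro conjI ballI)
  show "id \<in> carrier (Aut \<phi>)" by (simp add: Aut_iff id_in_PSL2C)
next
  fix g h assume "g \<in> carrier (Aut \<phi>)" "h \<in> carrier (Aut \<phi>)"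
  then show "g \<circ> h \<in> carrier (Aut \<phi>)" unfolding Aut_iff using PSL2C_comp commuting_comp by blast
next
  fix g assume g: "g \<in> carrier (Aut \<phi>)"
  then obtain S where S: "S \<in> carrier PSL2C" "S \<circ> g = id" "g \<circ> S = id"
    unfolding Aut_iff using PSL2C_inverse by blast
  then show "\<exists>h\<in>carrier (Aut \<phi>). h \<circ> g = id \<and> g \<circ> h = id"
    using commuting_inverse[OF _ S(2,3)] g by (intro bexI[of _ S]) (auto simp: Aut_iff)
qed

lemma transformation_group_full_Aut:
  "transformation_group (carrier (Aut \<phi>) \<union> antiholo_aut \<phi>)"
  unfolding transformation_group_def
proof (intro conjI ballI)
  show "id \<in> carrier (Aut \<phi>) \<union> antiholo_aut \<phi>" by (simp add: Aut_iff id_in_PSL2C)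
next
  fix g h assume "g \<in> carrier (Aut \<phi>) \<union> antiholo_aut \<phi>" "h \<in> carrier (Aut \<phi>) \<union> antiholo_aut \<phi>"
  moreover from this have "g \<circ> h \<circ> \<phi> = \<phi> \<circ> (g \<circ> h)"
    unfolding Un_iff Aut_iff antiholo_aut_iff using commuting_comp by blast
  ultimately show "g \<circ> h \<in> carrier (Aut \<phi>) \<union> antiholo_aut \<phi>"
    unfolding Un_iff Aut_iff antiholo_aut_iff
    by (metis PSL2C_comp PSL2C_comp_extended extended_comp_PSL2C extended_comp_extended)
next
  fix g assume "g \<in> carrier (Aut \<phi>) \<union> antiholo_aut \<phi>"
  then consider "g \<in> carrier (Aut \<phi>)" | "g \<in> antiholo_aut \<phi>" by blast
  then show "\<exists>h\<in>carrier (Aut \<phi>) \<union> antiholo_aut \<phi>. h \<circ> g = id \<and> g \<circ> h = id"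
  proof cases
    case 1
    then show ?thesis using transformation_groupD(3)[OF transformation_group_Aut] by blast
  next
    case 2
    then obtain S where S: "S \<in> extended_moebius" "S \<circ> g = id" "g \<circ> S = id"
      unfolding antiholo_aut_iff using extended_inverse by blast
    then show ?thesis
      using commuting_inverse[OF _ S(2,3)] 2 by (intro bexI[of _ S]) (auto simp: antiholo_aut_iff)
  qed
qed

text \<open>The square of \<open>Q\<close> is a holomorphic automorphism, so it has finite order.\<close>

lemma antiholo_aut_fixed_point_reflection:
  assumes "finite (carrier (Aut \<phi>))" "Q \<in> antiholo_aut \<phi>" "Q p = p"
  shows "is_reflection Q"
proof -
  have Q: "Q \<in> extended_moebius" "Q \<circ> \<phi> = \<phi> \<circ> Q" using assms(2) by (auto simp: antiholo_aut_iff)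
  have "Q \<circ> Q \<in> carrier (Aut \<phi>)"
    unfolding Aut_iff using extended_comp_extended[OF Q(1,1)] commuting_comp[OF Q(2,2)] by blast
  then obtain n where "n > 0" "(Q \<circ> Q) ^^ n = id"
    using finite_transformation_group_order[OF transformation_group_Aut assms(1)] by blast
  then show ?thesis by (rule extended_moebius_fixed_point_reflection[OF Q(1) assms(3)])
qed

text \<open>Composition with one antiholomorphic automorphism exchanges the two kinds.\<close>

lemma card_full_Aut:
  assumes fin: "finite (carrier (Aut \<phi>))" and Q: "Q \<in> antiholo_aut \<phi>"
    and disj: "carrier (Aut \<phi>) \<inter> antiholo_aut \<phi> = {}"
  shows "finite (antiholo_aut \<phi>)"
    and "card (carrier (Aut \<phi>) \<union> antiholo_aut \<phi>) = 2 * card (carrier (Aut \<phi>))"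
proof -
  have Q': "Q \<in> extended_moebius" "Q \<circ> \<phi> = \<phi> \<circ> Q" using Q by (auto simp: antiholo_aut_iff)
  obtain R where R: "R \<in> extended_moebius" "R \<circ> Q = id" "Q \<circ> R = id" by (rule extended_inverse[OF Q'(1)])
  have R': "R \<circ> \<phi> = \<phi> \<circ> R" by (rule commuting_inverse[OF Q'(2) R(2,3)])
  have bij: "bij_betw (\<lambda>g. Q \<circ> g) (carrier (Aut \<phi>)) (antiholo_aut \<phi>)"
  proof (rule bij_betw_byWitness[where f' = "\<lambda>h. R \<circ> h"])
    show "\<forall>g\<in>carrier (Aut \<phi>). R \<circ> (Q \<circ> g) = g" by (simp add: R(2) flip: comp_assoc)
    show "\<forall>h\<in>antiholo_aut \<phi>. Q \<circ> (R \<circ> h) = h" by (simp add: R(3) flip: comp_assoc)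
    show "(\<lambda>g. Q \<circ> g) ` carrier (Aut \<phi>) \<subseteq> antiholo_aut \<phi>"
      using extended_comp_PSL2C[OF Q'(1)] commuting_comp[OF Q'(2)]
      by (simp add: image_subset_iff Aut_iff antiholo_aut_iff)
    show "(\<lambda>h. R \<circ> h) ` antiholo_aut \<phi> \<subseteq> carrier (Aut \<phi>)"
      using extended_comp_extended[OF R(1)] commuting_comp[OF R']
      by (simp add: image_subset_iff Aut_iff antiholo_aut_iff)
  qed
  show "finite (antiholo_aut \<phi>)" using bij fin bij_betw_finite by blast
  then show "card (carrier (Aut \<phi>) \<union> antiholo_aut \<phi>) = 2 * card (carrier (Aut \<phi>))"
    using card_Un_disjoint[OF fin _ disj] bij_betw_same_card[OF bij] by simp
qed

lemma Aut_nat_pow: "x [^]\<^bsub>Aut \<phi>\<^esub> (n::nat) = x ^^ n"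
proof (induction n)
  case 0
  show ?case by (simp add: Aut_def PSL2C_def id_def)
next
  case (Suc n)
  have "x [^]\<^bsub>Aut \<phi>\<^esub> Suc n = x ^^ n \<circ> x" using Suc by (simp add: Aut_def PSL2C_def)
  then show ?case by (simp only: funpow_Suc_right)
qed

lemma cyclic_Aut_if_fixed_point:
  assumes fin: "finite (carrier (Aut \<phi>))" and p: "\<And>g. g \<in> carrier (Aut \<phi>) \<Longrightarrow> g p = p"
  shows "cyclic_group (Aut \<phi>)"
proof -
  interpret group "Aut \<phi>" by (rule group_Aut)
  have sub: "carrier (Aut \<phi>) \<subseteq> carrier PSL2C" by (simp add: Aut_iff subset_iff)
  have "\<exists>g0\<in>carrier (Aut \<phi>). \<forall>g\<in>carrier (Aut \<phi>). \<exists>k. g = g0 ^^ k"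
    by (rule finite_PSL2C_group_fixing_point_cyclic[OF transformation_group_Aut fin sub]) (rule p)
  then obtain g0 where g0: "g0 \<in> carrier (Aut \<phi>)"
    "\<And>g. g \<in> carrier (Aut \<phi>) \<Longrightarrow> \<exists>k. g = g0 ^^ k" by blast
  have "carrier (Aut \<phi>) = range (\<lambda>n::int. g0 [^]\<^bsub>Aut \<phi>\<^esub> n)"
  proof (intro equalityI subsetI)
    fix g assume "g \<in> carrier (Aut \<phi>)"
    then obtain k where "g = g0 ^^ k" using g0(2) by blast
    then have "g = g0 [^]\<^bsub>Aut \<phi>\<^esub> (int k)" by (simp add: int_pow_int Aut_nat_pow)
    then show "g \<in> range (\<lambda>n::int. g0 [^]\<^bsub>Aut \<phi>\<^esub> n)" by blast
  qed (use g0(1) in auto)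
  with g0(1) show ?thesis unfolding cyclic_group by blast
qed

theorem theorem5:
  fixes d :: nat and \<phi> :: "sphere \<Rightarrow> sphere"
  assumes "d \<ge> 2"
    and "\<phi> \<in> Rat_maps d"
    and "pseudo_real \<phi>"
  shows "trivial_group (Aut \<phi>) \<or> cyclic_group (Aut \<phi>)"
proof -
  let ?G = "carrier (Aut \<phi>)"
  let ?H = "?G \<union> antiholo_aut \<phi>"
  have fin: "finite ?G" by (rule finite_Aut[OF assms(1,2)])
  obtain Q where Q: "Q \<in> antiholo_aut \<phi>" using assms(3) by (auto simp: pseudo_real_def)
  have free: "h x \<noteq> x" if "h \<in> antiholo_aut \<phi>" for h x
    using antiholo_aut_fixed_point_reflection[OF fin that] assms(3) that
    by (auto simp: pseudo_real_def)
  have disj: "?G \<inter> antiholo_aut \<phi> = {}"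
    using free PSL2C_has_fixed_point by (force simp: Aut_iff)
  have two: "card {x. g x = x} = 2" if "g \<in> ?G" "g \<noteq> id" for g
    using PSL2C_finite_order_two_fixed_points[OF _ that(2)] that(1)
      finite_transformation_group_order[OF transformation_group_Aut fin that(1)]
    by (auto simp: Aut_iff)
  show ?thesis
  proof (cases "?G = {id}")
    case True
    have "trivial_group (Aut \<phi>)"
      using True group_Aut by (simp add: trivial_group_def) (simp add: Aut_def PSL2C_def)
    then show ?thesis ..
  next
    case False
    then obtain g0 where g0: "g0 \<in> ?G" "g0 \<noteq> id"
      using transformation_groupD(1)[OF transformation_group_Aut[of \<phi>]] by blast
    obtain p where p: "g0 p = p" using g0(1) PSL2C_has_fixed_point by (auto simp: Aut_iff)
    have finH: "finite ?H" using fin card_full_Aut(1)[OF fin Q disj] by simp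
    have "g p = p" if "g \<in> ?G" for g
    proof (rule index_two_free_complement_common_fixed_point[OF transformation_group_full_Aut finH])
      show "?G \<subseteq> ?H" by blast
      show "card ?H = 2 * card ?G" by (rule card_full_Aut(2)[OF fin Q disj])
      show "card {x. g x = x} = 2" if "g \<in> ?G" "g \<noteq> id" for g by (rule two[OF that])
      show "h x \<noteq> x" if "h \<in> ?H" "h \<notin> ?G" for h x using that free by blast
    qed (fact g0 p that)+
    then have "cyclic_group (Aut \<phi>)" by (rule cyclic_Aut_if_fixed_point[OF fin])
    then show ?thesis ..
  qed
qed

end
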